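(* Let $G$ be a finite directed multigraph with vertex set $\{1,\dots,n+1\}$ ($n\ge1$) having a global sink at $n+1$, with reduced Laplacian $\Delta$. Let $a$ be a critical configuration and let $b$ be a stable configuration with $b\sim a$. Then $w(a)\ge w(b)$.
   Context: Global sink: out-degree of $n+1$ is $0$ and every vertex has a directed path to $n+1$. $d^+_i$ is the out-degree of $i$, $e_{ij}$ the number of edges from $i$ to $j$. $\Delta$ is the $n\times n$ matrix with $\Delta_{ii}=d^+_i$, $\Delta_{ij}=-e_{ij}$ ($i\ne j$), rows $\Delta_i$. A configuration is $a\in\mathbb{Z}^n$; non-negative if all $a_i\ge0$, stable if $0\le a_i\le d^+_i-1$ for all $i$. Vertex $i$ is active if $a_i\ge d^+_i$; firing $i$ replaces $a$ by $a-\Delta_i$. For non-negative $c$, repeatedly firing active vertices terminates at a unique stable configuration $c^o$. $a\sim b$ means $a-b$ lies in the $\mathbb{Z}$-span of the rows of $\Delta$. The weight is $w(a)=\sum_ia_i$. Let $a_{\max}=(d^+_1-1,\dots,d^+_n-1)$; $a$ is critical if it is stable and $a=(a_{\max}+c)^o$ for some non-negative configuration $c$. *)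

theory Defs
  imports "Graph_Theory.Digraph"
begin

text \<open>
  A finite directed multigraph is an instance of \<^locale>\<open>fin_digraph\<close>: parallel arcs and loops
  are allowed. Loops count towards \<^const>\<open>out_degree\<close>, so a loop at a non-sink vertex \<open>i\<close>
  contributes to the diagonal entry \<open>\<Delta>\<^sub>i\<^sub>i\<close> of the reduced Laplacian, and loop-free graphs
  are a special case.
\<close>

definition global_sink :: "('a, 'e) pre_digraph \<Rightarrow> 'a \<Rightarrow> bool" where
  "global_sink G s \<longleftrightarrow>
     s \<in> verts G \<and> out_degree G s = 0 \<and> (\<forall>v \<in> verts G. v \<rightarrow>\<^sup>*\<^bsub>G\<^esub> s)"

definition num_arcs :: "('a, 'e) pre_digraph \<Rightarrow> 'a \<Rightarrow> 'a \<Rightarrow> nat" where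
  "num_arcs G i j = card {e \<in> arcs G. tail G e = i \<and> head G e = j}"

text \<open>
  An element of \<open>\<int>\<^sup>n\<close> with coordinates indexed by \<open>1, \<dots>, n\<close> is represented by the function
  on \<^typ>\<open>nat\<close> that extends it by \<open>0\<close>, so that equality of vectors is equality of functions.
  Matrices are treated in the same way.
\<close>

definition configs :: "nat \<Rightarrow> (nat \<Rightarrow> int) set" where
  "configs n = {a. \<forall>i. i \<notin> {1..n} \<longrightarrow> a i = 0}"

definition reduced_laplacian :: "(nat, 'e) pre_digraph \<Rightarrow> nat \<Rightarrow> nat \<Rightarrow> nat \<Rightarrow> int" where
  "reduced_laplacian G n i j =
     (if i \<in> {1..n} \<and> j \<in> {1..n}
      then (if i = j then int (out_degree G i) else - int (num_arcs G i j))
      else 0)"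

definition nonneg_config :: "nat \<Rightarrow> (nat \<Rightarrow> int) \<Rightarrow> bool" where
  "nonneg_config n a \<longleftrightarrow> a \<in> configs n \<and> (\<forall>i \<in> {1..n}. 0 \<le> a i)"

definition stable_config :: "(nat, 'e) pre_digraph \<Rightarrow> nat \<Rightarrow> (nat \<Rightarrow> int) \<Rightarrow> bool" where
  "stable_config G n a \<longleftrightarrow>
     a \<in> configs n \<and> (\<forall>i \<in> {1..n}. 0 \<le> a i \<and> a i \<le> int (out_degree G i) - 1)"

definition active :: "(nat, 'e) pre_digraph \<Rightarrow> nat \<Rightarrow> (nat \<Rightarrow> int) \<Rightarrow> nat \<Rightarrow> bool" where
  "active G n a i \<longleftrightarrow> i \<in> {1..n} \<and> int (out_degree G i) \<le> a i"

definition fire :: "(nat, 'e) pre_digraph \<Rightarrow> nat \<Rightarrow> nat \<Rightarrow> (nat \<Rightarrow> int) \<Rightarrow> (nat \<Rightarrow> int)" where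
  "fire G n i a = (\<lambda>j. a j - reduced_laplacian G n i j)"

definition firing_step :: "(nat, 'e) pre_digraph \<Rightarrow> nat \<Rightarrow> (nat \<Rightarrow> int) \<Rightarrow> (nat \<Rightarrow> int) \<Rightarrow> bool" where
  "firing_step G n a b \<longleftrightarrow> (\<exists>i. active G n a i \<and> b = fire G n i a)"

text \<open>
  The configuration \<open>c\<^sup>o\<close>; the description denotes something only where a stable
  configuration is reached and is unique, as it is for non-negative \<open>c\<close> on a graph with a global
  sink.
\<close>

definition stabilization :: "(nat, 'e) pre_digraph \<Rightarrow> nat \<Rightarrow> (nat \<Rightarrow> int) \<Rightarrow> (nat \<Rightarrow> int)" where
  "stabilization G n c = (THE b. (firing_step G n)\<^sup>*\<^sup>* c b \<and> stable_config G n b)"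

definition max_stable :: "(nat, 'e) pre_digraph \<Rightarrow> nat \<Rightarrow> (nat \<Rightarrow> int)" where
  "max_stable G n = (\<lambda>i. if i \<in> {1..n} then int (out_degree G i) - 1 else 0)"

definition critical_config :: "(nat, 'e) pre_digraph \<Rightarrow> nat \<Rightarrow> (nat \<Rightarrow> int) \<Rightarrow> bool" where
  "critical_config G n a \<longleftrightarrow>
     stable_config G n a \<and>
     (\<exists>c. nonneg_config n c \<and> a = stabilization G n (\<lambda>i. max_stable G n i + c i))"

definition config_equiv :: "(nat, 'e) pre_digraph \<Rightarrow> nat \<Rightarrow> (nat \<Rightarrow> int) \<Rightarrow> (nat \<Rightarrow> int) \<Rightarrow> bool" where
  "config_equiv G n a b \<longleftrightarrow>
     (\<exists>z :: nat \<Rightarrow> int. \<forall>j \<in> {1..n}. a j - b j = (\<Sum>i = 1..n. z i * reduced_laplacian G n i j))"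

definition weight :: "nat \<Rightarrow> (nat \<Rightarrow> int) \<Rightarrow> int" where
  "weight n a = (\<Sum>i = 1..n. a i)"

end

theory Submission
  imports Defs
begin

text \<open>
  Write \<open>b = a + z\<Delta>\<close> and let \<open>z\<^sup>+\<close>, \<open>z\<^sup>-\<close> be the positive and negative parts of \<open>z\<close>. Since \<open>a\<close> and
  \<open>b\<close> are at most \<open>a\<^sub>m\<^sub>a\<^sub>x\<close> and the off-diagonal entries of \<open>\<Delta>\<close> are non-positive, also
  \<open>a + z\<^sup>+\<Delta> \<le> a\<^sub>m\<^sub>a\<^sub>x\<close>. Criticality forces \<open>z\<^sup>+ = 0\<close>: if \<open>a = a\<^sub>m\<^sub>a\<^sub>x + c - \<tau>\<Delta>\<close> with \<open>\<tau>\<close> counting the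
  firings of a stabilization, then \<open>(\<tau> - z\<^sup>+)\<Delta> \<ge> 0\<close>, hence \<open>\<tau> - z\<^sup>+ \<ge> 0\<close> because \<open>\<Delta>\<close> is an
  M-matrix, and \<open>\<tau> \<le> \<tau> - z\<^sup>+\<close> by the least action principle. So \<open>b = a - z\<^sup>-\<Delta>\<close>, and the row sums
  of \<open>\<Delta>\<close> are non-negative.
\<close>

locale sandpile_graph = fin_digraph G for G :: "(nat, 'e) pre_digraph" +
  fixes n :: nat
  assumes verts_G: "verts G = {1..n + 1}"
    and sink: "global_sink G (n + 1)"
begin

section \<open>The reduced Laplacian: signs, partial row sums, M-matrix property\<close>

abbreviation \<Delta> :: "nat \<Rightarrow> nat \<Rightarrow> int" where
  "\<Delta> \<equiv> reduced_laplacian G n"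

definition row_comb :: "(nat \<Rightarrow> int) \<Rightarrow> nat \<Rightarrow> int" where
  "row_comb z j = (\<Sum>i = 1..n. z i * \<Delta> i j)"

lemma row_comb_add: "row_comb (\<lambda>i. x i + y i) j = row_comb x j + row_comb y j"
  by (simp add: row_comb_def sum.distrib distrib_right)

lemma row_comb_diff: "row_comb (\<lambda>i. x i - y i) j = row_comb x j - row_comb y j"
  by (simp add: row_comb_def sum_subtractf left_diff_distrib)

lemma row_comb_minus: "row_comb (\<lambda>i. - x i) j = - row_comb x j"
  by (simp add: row_comb_def sum_negf)

lemma row_comb_unit:
  assumes "i \<in> {1..n}"
  shows "row_comb (\<lambda>k. if k = i then 1 else 0) j = \<Delta> i j"
  using assms by (simp add: row_comb_def if_distrib[of "\<lambda>x. x * _"] cong: if_cong)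

lemma laplacian_offdiag_nonpos: "i \<noteq> j \<Longrightarrow> \<Delta> i j \<le> 0"
  by (simp add: reduced_laplacian_def)

text \<open>The diagonal term of column \<open>j\<close> vanishes, leaving non-negative multiples of
  off-diagonal entries.\<close>

lemma row_comb_nonpos_off_support:
  assumes "\<And>i. i \<in> {1..n} \<Longrightarrow> 0 \<le> z i" and "z j = 0"
  shows "row_comb z j \<le> 0"
  unfolding row_comb_def
proof (rule sum_nonpos)
  fix i assume "i \<in> {1..n}"
  then show "z i * \<Delta> i j \<le> 0"
    using assms laplacian_offdiag_nonpos[of i j] by (cases "i = j") (auto simp: mult_nonneg_nonpos)
qed

text \<open>The arcs from \<open>i\<close> into \<open>N - {i}\<close> cancel against part of the
  out-degree on the diagonal. What remains are the arcs leaving \<open>N\<close> and the loops at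
  \<open>i\<close>; the loops account for the inequality.\<close>

lemma laplacian_partial_row_sum:
  assumes "N \<subseteq> {1..n}" and "i \<in> N"
  shows "(\<Sum>j\<in>N. \<Delta> i j) \<ge> int (card {e \<in> out_arcs G i. head G e \<notin> N})"
proof -
  have fin: "finite N" using assms(1) finite_subset by blast
  define A where "A = (\<Union>j\<in>N - {i}. {e \<in> arcs G. tail G e = i \<and> head G e = j})"
  define B where "B = {e \<in> out_arcs G i. head G e \<notin> N}"
  have "(\<Sum>j\<in>N - {i}. num_arcs G i j) = card A"
    unfolding A_def num_arcs_def using fin by (subst card_UN_disjoint) auto
  moreover have "card A + card B = card (A \<union> B)"
    by (rule card_Un_disjoint[symmetric])
       (auto simp: A_def B_def fin intro: finite_subset[OF _ finite_arcs])
  moreover have "card (A \<union> B) \<le> out_degree G i"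
    unfolding out_degree_def by (rule card_mono) (auto simp: A_def B_def)
  ultimately have le: "(\<Sum>j\<in>N - {i}. num_arcs G i j) + card B \<le> out_degree G i"
    by simp
  have "(\<Sum>j\<in>N. \<Delta> i j) = \<Delta> i i + (\<Sum>j\<in>N - {i}. \<Delta> i j)"
    using fin assms(2) by (rule sum.remove)
  also have "\<Delta> i i = int (out_degree G i)"
    using assms by (auto simp: reduced_laplacian_def)
  also have "(\<Sum>j\<in>N - {i}. \<Delta> i j) = (\<Sum>j\<in>N - {i}. - int (num_arcs G i j))"
    using assms by (intro sum.cong) (auto simp: reduced_laplacian_def)
  also have "\<dots> = - int (\<Sum>j\<in>N - {i}. num_arcs G i j)"
    by (simp add: sum_negf)
  finally show ?thesis
    using le unfolding B_def by linarith
qed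

lemma laplacian_partial_row_sum_nonneg:
  assumes "N \<subseteq> {1..n}" and "i \<in> N"
  shows "0 \<le> (\<Sum>j\<in>N. \<Delta> i j)"
  using laplacian_partial_row_sum[OF assms] by linarith

text \<open>Otherwise a directed path from a vertex of \<open>N\<close> to the sink would stay in
  \<open>N\<close>, which does not contain \<open>n + 1\<close>.\<close>

lemma exists_leaving_arc:
  assumes "N \<subseteq> {1..n}" and "N \<noteq> {}"
  shows "\<exists>i\<in>N. \<exists>e\<in>out_arcs G i. head G e \<notin> N"
proof (rule ccontr)
  assume closed: "\<not> ?thesis"
  obtain v where v: "v \<in> N" using assms(2) by blast
  then have "v \<in> verts G" using assms(1) verts_G by auto
  then have "v \<rightarrow>\<^sup>*\<^bsub>G\<^esub> (n + 1)" using sink by (auto simp: global_sink_def)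
  then have "n + 1 \<in> N"
  proof (induction rule: reachable_induct)
    case base
    show ?case by (rule v)
  next
    case (step x y)
    then obtain e where "e \<in> arcs G" "tail G e = x" "head G e = y"
      by (auto simp: arcs_ends_def arc_to_ends_def)
    with step closed show ?case by auto
  qed
  then show False using assms(1) by auto
qed

text \<open>Let \<open>N\<close> be the set where \<open>z\<close> is negative and sum
  \<open>row_comb z\<close> over the columns in \<open>N\<close>. Rows in \<open>N\<close> have
  non-negative partial sums and negative coefficients, rows outside \<open>N\<close> the opposite
  signs, so no term is positive. A row with an arc leaving \<open>N\<close> makes the total strictly
  negative.\<close>

lemma row_comb_monotone:
  assumes nonneg: "\<And>j. j \<in> {1..n} \<Longrightarrow> 0 \<le> row_comb z j" and "k \<in> {1..n}"
  shows "0 \<le> z k"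
proof (rule ccontr)
  assume neg: "\<not> 0 \<le> z k"
  define N where "N = {i \<in> {1..n}. z i < 0}"
  have N: "N \<subseteq> {1..n}" "N \<noteq> {}" using neg assms(2) by (auto simp: N_def)
  obtain i e where i: "i \<in> N" and e: "e \<in> out_arcs G i" "head G e \<notin> N"
    using exists_leaving_arc[OF N] by blast
  have "0 < card {e \<in> out_arcs G i. head G e \<notin> N}"
    using e by (auto simp: card_gt_0_iff)
  then have pos: "0 < (\<Sum>j\<in>N. \<Delta> i j)"
    using laplacian_partial_row_sum[OF N(1) i] by linarith
  have "0 \<le> (\<Sum>j\<in>N. row_comb z j)"
    using N nonneg by (intro sum_nonneg) auto
  also have "\<dots> = (\<Sum>l = 1..n. z l * (\<Sum>j\<in>N. \<Delta> l j))"
    unfolding row_comb_def sum_distrib_left by (rule sum.swap)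
  also have "\<dots> < (\<Sum>l = 1..n. 0)"
  proof (rule sum_strict_mono_ex1)
    show "\<forall>l\<in>{1..n}. z l * (\<Sum>j\<in>N. \<Delta> l j) \<le> 0"
    proof
      fix l assume l: "l \<in> {1..n}"
      show "z l * (\<Sum>j\<in>N. \<Delta> l j) \<le> 0"
      proof (cases "l \<in> N")
        case True
        then show ?thesis
          using laplacian_partial_row_sum_nonneg[OF N(1) True]
          by (auto simp: N_def mult_nonpos_nonneg)
      next
        case False
        then have "(\<Sum>j\<in>N. \<Delta> l j) \<le> 0"
          by (intro sum_nonpos laplacian_offdiag_nonpos) auto
        with False l show ?thesis by (auto simp: N_def mult_nonneg_nonpos)
      qed
    qed
    show "\<exists>l\<in>{1..n}. z l * (\<Sum>j\<in>N. \<Delta> l j) < 0"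
      using i pos by (intro bexI[of _ i]) (auto simp: N_def mult_neg_pos)
  qed simp
  finally show False by simp
qed

section \<open>Firing vectors, least action and uniqueness of the stable result\<close>

text \<open>The last clause is the least action principle.\<close>

lemma firing_least_action:
  assumes "(firing_step G n)\<^sup>*\<^sup>* x y"
  shows "\<exists>\<tau>. (\<forall>i. 0 \<le> \<tau> i) \<and> y = (\<lambda>j. x j - row_comb \<tau> j) \<and>
    (\<forall>\<rho>. (\<forall>i\<in>{1..n}. 0 \<le> \<rho> i) \<longrightarrow>
         (\<forall>j\<in>{1..n}. x j - row_comb \<rho> j \<le> max_stable G n j) \<longrightarrow>
         (\<forall>i\<in>{1..n}. \<tau> i \<le> \<rho> i))"
  using assms
proof (induction rule: rtranclp_induct)
  case base
  show ?case by (rule exI[of _ "\<lambda>_. 0"]) (simp add: row_comb_def)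
next
  case (step y z)
  from step.IH obtain \<tau> where \<tau>: "\<And>i. 0 \<le> \<tau> i" "y = (\<lambda>j. x j - row_comb \<tau> j)"
    and least: "\<And>\<rho> i. \<lbrakk>\<forall>i\<in>{1..n}. 0 \<le> \<rho> i;
         \<forall>j\<in>{1..n}. x j - row_comb \<rho> j \<le> max_stable G n j; i \<in> {1..n}\<rbrakk> \<Longrightarrow> \<tau> i \<le> \<rho> i"
    by blast
  from step.hyps(2) obtain k where k: "k \<in> {1..n}" "int (out_degree G k) \<le> y k"
    and z: "z = fire G n k y"
    by (auto simp: firing_step_def active_def)
  define \<tau>' where "\<tau>' = (\<lambda>i. \<tau> i + (if i = k then 1 else 0))"
  show ?case
  proof (intro exI[of _ \<tau>'] conjI allI impI ballI)
    show "0 \<le> \<tau>' i" for i using \<tau>(1)[of i] by (simp add: \<tau>'_def)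
    show "z = (\<lambda>j. x j - row_comb \<tau>' j)"
      unfolding z fire_def \<tau>(2) \<tau>'_def row_comb_add row_comb_unit[OF k(1)] by (simp add: algebra_simps)
    fix \<rho> i
    assume \<rho>: "\<forall>i\<in>{1..n}. 0 \<le> \<rho> i" "\<forall>j\<in>{1..n}. x j - row_comb \<rho> j \<le> max_stable G n j"
      and i: "i \<in> {1..n}"
    have le: "\<tau> j \<le> \<rho> j" if "j \<in> {1..n}" for j using least[OF \<rho> that] .
    \<comment> \<open>The competitor \<open>\<rho>\<close> need not come from legal firings. If it
      fires \<open>k\<close> only \<open>\<tau> k\<close> times, its surplus over
      \<open>\<tau>\<close> lies at other vertices and can only raise the value at \<open>k\<close>,
      which is already at least the out-degree in \<open>y\<close>.\<close>
    have "\<tau> k \<noteq> \<rho> k"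
    proof
      assume "\<tau> k = \<rho> k"
      then have "row_comb (\<lambda>i. \<rho> i - \<tau> i) k \<le> 0"
        using le by (intro row_comb_nonpos_off_support) auto
      then have "y k \<le> x k - row_comb \<rho> k"
        by (simp add: \<tau>(2) row_comb_diff)
      also have "\<dots> < int (out_degree G k)"
        using \<rho>(2) k(1) by (force simp: max_stable_def)
      finally show False using k(2) by simp
    qed
    then show "\<tau>' i \<le> \<rho> i"
      using le[OF i] by (auto simp: \<tau>'_def)
  qed
qed

lemma stable_le_max_stable:
  "stable_config G n a \<Longrightarrow> j \<in> {1..n} \<Longrightarrow> a j \<le> max_stable G n j"
  by (auto simp: stable_config_def max_stable_def)

text \<open>The firing vector of each stabilization is an admissible competitor for the other, so
  least action applies in both directions.\<close>

lemma stable_unique: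
  assumes "(firing_step G n)\<^sup>*\<^sup>* x y" "stable_config G n y"
    and "(firing_step G n)\<^sup>*\<^sup>* x z" "stable_config G n z"
  shows "y = z"
proof -
  obtain \<tau> where \<tau>: "\<And>i. 0 \<le> \<tau> i" "y = (\<lambda>j. x j - row_comb \<tau> j)"
    and \<tau>_least: "\<And>\<rho> i. \<lbrakk>\<forall>i\<in>{1..n}. 0 \<le> \<rho> i;
         \<forall>j\<in>{1..n}. x j - row_comb \<rho> j \<le> max_stable G n j; i \<in> {1..n}\<rbrakk> \<Longrightarrow> \<tau> i \<le> \<rho> i"
    using firing_least_action[OF assms(1)] by blast
  obtain \<sigma> where \<sigma>: "\<And>i. 0 \<le> \<sigma> i" "z = (\<lambda>j. x j - row_comb \<sigma> j)"
    and \<sigma>_least: "\<And>\<rho> i. \<lbrakk>\<forall>i\<in>{1..n}. 0 \<le> \<rho> i;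
         \<forall>j\<in>{1..n}. x j - row_comb \<rho> j \<le> max_stable G n j; i \<in> {1..n}\<rbrakk> \<Longrightarrow> \<sigma> i \<le> \<rho> i"
    using firing_least_action[OF assms(3)] by blast
  have "\<tau> i \<le> \<sigma> i" if "i \<in> {1..n}" for i
    using \<tau>_least[OF _ _ that, of \<sigma>] \<sigma> stable_le_max_stable[OF assms(4)] by auto
  moreover have "\<sigma> i \<le> \<tau> i" if "i \<in> {1..n}" for i
    using \<sigma>_least[OF _ _ that, of \<tau>] \<tau> stable_le_max_stable[OF assms(2)] by auto
  ultimately have "\<tau> i = \<sigma> i" if "i \<in> {1..n}" for i
    using that by (simp add: order_antisym)
  then have "row_comb \<tau> j = row_comb \<sigma> j" for j
    unfolding row_comb_def by (intro sum.cong) auto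
  then show ?thesis by (simp add: \<tau>(2) \<sigma>(2))
qed

text \<open>A cycle would give a non-negative, non-zero firing vector with zero row combination;
  \<open>row_comb_monotone\<close> applied to its negative excludes this.\<close>

lemma firing_step_acyclic: "\<not> (firing_step G n)\<^sup>+\<^sup>+ x x"
proof
  assume "(firing_step G n)\<^sup>+\<^sup>+ x x"
  then obtain y where "firing_step G n x y" and yx: "(firing_step G n)\<^sup>*\<^sup>* y x"
    by (auto dest: tranclpD)
  then obtain k where k: "k \<in> {1..n}" and y: "y = fire G n k x"
    by (auto simp: firing_step_def active_def)
  obtain \<tau> where \<tau>: "\<And>i. 0 \<le> \<tau> i" "x = (\<lambda>j. y j - row_comb \<tau> j)"
    using firing_least_action[OF yx] by blast
  define \<tau>' where "\<tau>' = (\<lambda>i. \<tau> i + (if i = k then 1 else 0))"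
  have "row_comb \<tau>' j = 0" for j
    using fun_cong[OF \<tau>(2), of j]
    unfolding y fire_def \<tau>'_def row_comb_add row_comb_unit[OF k] by linarith
  then have "0 \<le> - \<tau>' k"
    using row_comb_monotone[of "\<lambda>i. - \<tau>' i", OF _ k] by (simp add: row_comb_minus)
  then show False using \<tau>(1)[of k] by (simp add: \<tau>'_def)
qed

section \<open>Weight bounds and existence of stabilizations\<close>

lemma firing_step_nonneg:
  assumes "nonneg_config n x" and "firing_step G n x y"
  shows "nonneg_config n y"
proof -
  obtain k where k: "k \<in> {1..n}" "int (out_degree G k) \<le> x k" and y: "y = fire G n k x"
    using assms(2) by (auto simp: firing_step_def active_def)
  show ?thesis
    using assms(1) k unfolding y nonneg_config_def configs_def fire_def
    by (auto simp: reduced_laplacian_def)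
qed

lemma weight_row_comb_nonneg:
  assumes "\<And>i. i \<in> {1..n} \<Longrightarrow> 0 \<le> z i"
  shows "0 \<le> weight n (row_comb z)"
proof -
  have "weight n (row_comb z) = (\<Sum>i = 1..n. z i * (\<Sum>j = 1..n. \<Delta> i j))"
    unfolding weight_def row_comb_def sum_distrib_left by (rule sum.swap)
  also have "\<dots> \<ge> 0"
    by (intro sum_nonneg mult_nonneg_nonneg assms laplacian_partial_row_sum_nonneg) auto
  finally show ?thesis .
qed

text \<open>Firing keeps coordinates non-negative and never increases the weight, so everything
  reachable lies in the box with bound \<open>weight n x\<close>.\<close>

lemma finite_reachable_configs:
  assumes "nonneg_config n x"
  shows "finite {y. (firing_step G n)\<^sup>*\<^sup>* x y}"
proof (rule finite_subset)
  show "{y. (firing_step G n)\<^sup>*\<^sup>* x y}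
      \<subseteq> {y. \<forall>i. (i \<in> {1..n} \<longrightarrow> y i \<in> {0..weight n x}) \<and> (i \<notin> {1..n} \<longrightarrow> y i = 0)}"
  proof
    fix y assume "y \<in> {y. (firing_step G n)\<^sup>*\<^sup>* x y}"
    then have xy: "(firing_step G n)\<^sup>*\<^sup>* x y" by simp
    then have nn: "nonneg_config n y"
      by (induction rule: rtranclp_induct) (auto intro: assms firing_step_nonneg)
    obtain \<tau> where \<tau>: "\<And>i. 0 \<le> \<tau> i" "y = (\<lambda>j. x j - row_comb \<tau> j)"
      using firing_least_action[OF xy] by blast
    have "weight n y = weight n x - weight n (row_comb \<tau>)"
      by (simp add: \<tau>(2) weight_def sum_subtractf)
    then have "weight n y \<le> weight n x"
      using weight_row_comb_nonneg[of \<tau>] \<tau>(1) by simp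
    moreover have "y i \<le> weight n y" if "i \<in> {1..n}" for i
      unfolding weight_def using nn that
      by (intro member_le_sum) (auto simp: nonneg_config_def)
    ultimately show "y \<in> {y. \<forall>i. (i \<in> {1..n} \<longrightarrow> y i \<in> {0..weight n x}) \<and> (i \<notin> {1..n} \<longrightarrow> y i = 0)}"
      using nn by (force simp: nonneg_config_def configs_def)
  qed
  show "finite {y. \<forall>i. (i \<in> {1..n} \<longrightarrow> y i \<in> {0..weight n x}) \<and> (i \<notin> {1..n} \<longrightarrow> y i = (0::int))}"
    by (rule finite_set_of_finite_funs) auto
qed

text \<open>On the finite set \<open>R\<close> of reachable configurations firing is acyclic, so its
  converse is well-founded. A minimal element admits no firing, and being non-negative it is
  stable.\<close>

lemma exists_stabilization:
  assumes "nonneg_config n x"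
  shows "\<exists>y. (firing_step G n)\<^sup>*\<^sup>* x y \<and> stable_config G n y"
proof -
  define R where "R = {y. (firing_step G n)\<^sup>*\<^sup>* x y}"
  define r where "r = {(y, z). firing_step G n y z} \<inter> R \<times> R"
  have "acyclic r"
  proof (rule acyclicI, intro allI)
    fix y
    have "(y, y) \<notin> {(y, z). firing_step G n y z}\<^sup>+"
      using firing_step_acyclic[of y] by (simp add: tranclp_unfold)
    moreover have "r\<^sup>+ \<subseteq> {(y, z). firing_step G n y z}\<^sup>+"
      unfolding r_def by (meson Int_lower1 subrelI trancl_mono)
    ultimately show "(y, y) \<notin> r\<^sup>+" by blast
  qed
  moreover have "finite r"
    using finite_reachable_configs[OF assms] unfolding r_def R_def by blast
  ultimately have "wf (r\<inverse>)" by (simp add: finite_acyclic_wf_converse)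
  moreover have "x \<in> R" by (simp add: R_def)
  ultimately obtain y where y: "y \<in> R" and normal: "\<And>z. (z, y) \<in> r\<inverse> \<Longrightarrow> z \<notin> R"
    by (metis wfE_min)
  have xy: "(firing_step G n)\<^sup>*\<^sup>* x y" using y by (simp add: R_def)
  then have nn: "nonneg_config n y"
    by (induction rule: rtranclp_induct) (auto intro: assms firing_step_nonneg)
  have "\<not> firing_step G n y z" for z
  proof
    assume yz: "firing_step G n y z"
    with xy have "z \<in> R" by (simp add: R_def)
    moreover from this y yz have "(z, y) \<in> r\<inverse>" by (simp add: r_def)
    ultimately show False using normal by blast
  qed
  then have "\<not> active G n y i" for i by (auto simp: firing_step_def)
  with nn have "stable_config G n y"
    by (force simp: stable_config_def nonneg_config_def active_def)
  with xy show ?thesis by blast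
qed

text \<open>Existence and uniqueness together let the definite description in
  \<open>stabilization\<close> denote.\<close>

lemma stabilization_reachable:
  assumes "nonneg_config n x"
  shows "(firing_step G n)\<^sup>*\<^sup>* x (stabilization G n x)"
proof -
  have "\<exists>!y. (firing_step G n)\<^sup>*\<^sup>* x y \<and> stable_config G n y"
    using exists_stabilization[OF assms] stable_unique by blast
  from theI'[OF this] show ?thesis unfolding stabilization_def by blast
qed

section \<open>Critical configurations and maximality of their weight\<close>

lemma critical_no_reverse_firing:
  assumes crit: "critical_config G n a"
    and \<sigma>: "\<And>i. i \<in> {1..n} \<Longrightarrow> 0 \<le> \<sigma> i"
    and le: "\<And>j. j \<in> {1..n} \<Longrightarrow> a j + row_comb \<sigma> j \<le> max_stable G n j"
    and i: "i \<in> {1..n}"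
  shows "\<sigma> i = 0"
proof -
  obtain c where c: "nonneg_config n c"
    and a: "a = stabilization G n (\<lambda>i. max_stable G n i + c i)"
    and stable: "stable_config G n a"
    using crit by (auto simp: critical_config_def)
  define x where "x = (\<lambda>i. max_stable G n i + c i)"
  \<comment> \<open>Stability of \<open>a\<close> forces every non-sink out-degree to be at least
    1.\<close>
  have "0 \<le> max_stable G n j" if "j \<in> {1..n}" for j
    using stable that by (force simp: stable_config_def max_stable_def)
  then have "nonneg_config n x"
    using c by (auto simp: nonneg_config_def configs_def x_def max_stable_def)
  then have "(firing_step G n)\<^sup>*\<^sup>* x a"
    using stabilization_reachable unfolding a x_def by blast
  then obtain \<tau> where \<tau>: "\<And>i. 0 \<le> \<tau> i" "a = (\<lambda>j. x j - row_comb \<tau> j)"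
    and least: "\<And>\<rho> i. \<lbrakk>\<forall>i\<in>{1..n}. 0 \<le> \<rho> i;
         \<forall>j\<in>{1..n}. x j - row_comb \<rho> j \<le> max_stable G n j; i \<in> {1..n}\<rbrakk> \<Longrightarrow> \<tau> i \<le> \<rho> i"
    using firing_least_action by blast
  \<comment> \<open>Firing \<open>\<rho>\<close> takes \<open>x\<close> to
    \<open>a + row_comb \<sigma>\<close>, which is at most \<open>max_stable\<close> and hence at
    most \<open>x\<close>. So \<open>row_comb \<rho>\<close> is non-negative, which makes
    \<open>\<rho>\<close> non-negative and a competitor for \<open>\<tau>\<close>.\<close>
  define \<rho> where "\<rho> = (\<lambda>i. \<tau> i - \<sigma> i)"
  have x\<rho>: "x j - row_comb \<rho> j \<le> max_stable G n j" if "j \<in> {1..n}" for j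
    using le[OF that] unfolding \<rho>_def row_comb_diff \<tau>(2) by simp
  have "0 \<le> row_comb \<rho> j" if "j \<in> {1..n}" for j
  proof -
    have "max_stable G n j \<le> x j"
      using c that by (simp add: x_def nonneg_config_def)
    then show ?thesis using x\<rho>[OF that] by simp
  qed
  then have "0 \<le> \<rho> j" if "j \<in> {1..n}" for j
    using row_comb_monotone that by blast
  then have "\<tau> i \<le> \<rho> i"
    using least x\<rho> i by blast
  then show ?thesis using \<sigma>[OF i] by (simp add: \<rho>_def)
qed

lemma critical_weight_maximal:
  assumes crit: "critical_config G n a"
    and stable: "stable_config G n b"
    and equiv: "config_equiv G n b a"
  shows "weight n b \<le> weight n a"
proof -
  obtain z where z: "\<And>j. j \<in> {1..n} \<Longrightarrow> b j - a j = row_comb z j"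
    using equiv unfolding config_equiv_def row_comb_def by blast
  define p where "p = (\<lambda>i. max (z i) 0)"
  define q where "q = (\<lambda>i. max (- z i) 0)"
  have "z = (\<lambda>i. p i - q i)" by (auto simp: p_def q_def max_def)
  then have b: "b j = a j + row_comb p j - row_comb q j" if "j \<in> {1..n}" for j
    using z[OF that] by (simp add: row_comb_diff)
  have a_stable: "stable_config G n a" using crit by (simp add: critical_config_def)
  \<comment> \<open>Since \<open>p\<close> and \<open>q\<close> have disjoint supports, at each
    \<open>j\<close> either \<open>p\<close> is zero and the left side is at most
    \<open>a j\<close>, or \<open>q\<close> is zero and the left side, equal to
    \<open>b j + row_comb q j\<close>, is at most \<open>b j\<close>.\<close>
  have "a j + row_comb p j \<le> max_stable G n j" if j: "j \<in> {1..n}" for j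
  proof (cases "p j = 0")
    case True
    then have "row_comb p j \<le> 0"
      by (intro row_comb_nonpos_off_support) (auto simp: p_def)
    then show ?thesis using stable_le_max_stable[OF a_stable j] by simp
  next
    case False
    then have "q j = 0" by (auto simp: p_def q_def)
    then have "row_comb q j \<le> 0"
      by (intro row_comb_nonpos_off_support) (auto simp: q_def)
    then show ?thesis using stable_le_max_stable[OF stable j] b[OF j] by simp
  qed
  then have "p i = 0" if "i \<in> {1..n}" for i
    using critical_no_reverse_firing[OF crit, of p i] that by (auto simp: p_def)
  then have "row_comb p j = 0" for j by (simp add: row_comb_def)
  then have "weight n b = weight n (\<lambda>j. a j - row_comb q j)"
    unfolding weight_def by (intro sum.cong) (auto simp: b)
  also have "\<dots> = weight n a - weight n (row_comb q)"
    by (simp add: weight_def sum_subtractf)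
  also have "\<dots> \<le> weight n a"
    using weight_row_comb_nonneg[of q] by (simp add: q_def)
  finally show ?thesis .
qed

end

theorem theorem3p9:
  fixes G :: "(nat, 'e) pre_digraph" and n :: nat and a b :: "nat \<Rightarrow> int"
  assumes "n \<ge> 1"
    and "fin_digraph G"
    and "verts G = {1..n + 1}"
    and "global_sink G (n + 1)"
    and "critical_config G n a"
    and "stable_config G n b"
    and "config_equiv G n b a"
  shows "weight n a \<ge> weight n b"
proof -
  interpret fin_digraph G by fact
  interpret sandpile_graph G n by unfold_locales fact+
  show ?thesis using assms(5-7) by (rule critical_weight_maximal)
qed

end
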